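(* Let $p$ be a prime and $d\in\mathbb{N}$. Let $b_1(X),\ldots,b_d(X)\in \mathbb{F}_p[X]$ be pairwise relatively prime polynomials with degrees $e_1,\ldots ,e_d\geq 1$, and let $\mathcal{S}$ be the $d$-dimensional Halton-type sequence in bases $b_1(X),\ldots,b_d(X)$, with $P_N$ its first $N$ points. Suppose one of the following holds: (1) $d=2$, $b_1(X)=X+a$, and $b_2(X)=X+a+1$ for some $a\in \mathbb{F}_p$; (2) $d=3$, $p=2$, $b_1(X)=X$, $b_2(X)=X+1$, and $b_3(X)=X^2+X+1$; (3) $d=p$, $b_1(X)=X$, $b_2(X)=X-1$, $\ldots$, $b_p(X)=X-(p-1)$. Then there exists a constant $c>0$ (depending on the case) such that for infinitely many $N\in\mathbb{N}$, \[ q(P_N) \le \frac{c}{N^{1/(d-1)}}. \] In particular, each of these sequences is not quasi-uniform.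
   Context: $\mathbb{F}_p=\{0,1,\ldots,p-1\}$ with arithmetic mod $p$. For $b(X)\in\mathbb{F}_p[X]$ of degree $e\ge1$ and $n\in\mathbb{N}_0$ with base-$p$ expansion $n=n_0+n_1p+n_2p^2+\cdots$, let $n(X)=\sum_i n_iX^i\in\mathbb{F}_p[X]$ and expand $n(X)=\sum_{j\ge0}a_j(X)b(X)^j$ with $a_j(X)\in\mathbb{F}_p[X]$, $\deg a_j<e$. The $b(X)$-adic radical inverse is $\varphi_{b(X)}(n)=\sum_{j\ge0}a_j(p)/(p^e)^{j+1}\in[0,1)$, where $a_j(p)$ is computed by viewing the coefficients of $a_j$ as integers in $\{0,\ldots,p-1\}$. The Halton-type sequence in pairwise coprime bases $b_1(X),\ldots,b_d(X)$ is $\boldsymbol{x}_n=(\varphi_{b_1(X)}(n),\ldots,\varphi_{b_d(X)}(n))$. For $P_N=\{\boldsymbol{x}_0,\ldots,\boldsymbol{x}_{N-1}\}$: covering radius $h(P_N)=\sup_{\boldsymbol{x}\in[0,1]^d}\min_{0\le i<N}\|\boldsymbol{x}-\boldsymbol{x}_i\|$, separation radius $q(P_N)=\frac12\min_{0\le i<j<N}\|\boldsymbol{x}_i-\boldsymbol{x}_j\|$ (Euclidean norm). A sequence is quasi-uniform if there is $C>0$ with $h(P_N)/q(P_N)\le C$ for all $N\ge2$. *)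

theory Defs
  imports "HOL-Analysis.Analysis" "Berlekamp_Zassenhaus.Finite_Field"
begin

text \<open>
  The field with \<open>p\<close> elements is \<open>'p mod_ring\<close> with \<open>'p :: prime_card\<close> and \<open>p = CARD('p)\<close>;
  \<open>to_int_mod_ring\<close> gives the representative in \<open>{0, \<dots>, p - 1}\<close>.
\<close>

text \<open>The sum may stop at \<open>n\<close> because \<open>n < p ^ n\<close>; see \<open>coeff_nat_poly\<close>.\<close>

definition nat_poly :: "nat \<Rightarrow> 'p::prime_card mod_ring poly" where
  "nat_poly n = (\<Sum>i<n. Polynomial.monom (of_nat (n div CARD('p) ^ i mod CARD('p))) i)"

text \<open>
  The coefficient \<open>a\<^sub>j\<close> in the expansion \<open>f = (\<Sum>j. a\<^sub>j * b ^ j)\<close> with \<open>degree a\<^sub>j < degree b\<close>;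
  existence and uniqueness of this expansion are \<open>badic_expansion\<close>,
  \<open>degree_badic_digit\<close> and \<open>badic_digit_unique\<close> below.
\<close>

definition badic_digit :: "'a::field poly \<Rightarrow> 'a poly \<Rightarrow> nat \<Rightarrow> 'a poly" where
  "badic_digit b f j = f div b ^ j mod b"

definition eval_at_p :: "'p::prime_card mod_ring poly \<Rightarrow> int" where
  "eval_at_p a = poly (map_poly to_int_mod_ring a) (int CARD('p))"

definition radical_inverse :: "'p::prime_card mod_ring poly \<Rightarrow> nat \<Rightarrow> real" where
  "radical_inverse b n =
     (\<Sum>j. real_of_int (eval_at_p (badic_digit b (nat_poly n) j))
            / (real CARD('p) ^ degree b) ^ (j + 1))"

text \<open>
  Points of \<open>d\<close>-dimensional space are functions \<open>nat \<Rightarrow> real\<close> of which only the coordinates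
  in \<open>{1..d}\<close> matter.
\<close>

definition halton :: "(nat \<Rightarrow> 'p::prime_card mod_ring poly) \<Rightarrow> nat \<Rightarrow> nat \<Rightarrow> real" where
  "halton b n i = radical_inverse (b i) n"

definition edist :: "nat \<Rightarrow> (nat \<Rightarrow> real) \<Rightarrow> (nat \<Rightarrow> real) \<Rightarrow> real" where
  "edist d x y = L2_set (\<lambda>i. x i - y i) {1..d}"

definition covering_radius :: "nat \<Rightarrow> (nat \<Rightarrow> nat \<Rightarrow> real) \<Rightarrow> nat \<Rightarrow> real" where
  "covering_radius d s N =
     (SUP x \<in> {1..d} \<rightarrow>\<^sub>E {0..1}. Min ((\<lambda>i. edist d x (s i)) ` {..<N}))"

text \<open>Meaningful for \<open>N \<ge> 2\<close> only: otherwise the minimum is over the empty set.\<close>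

definition separation_radius :: "nat \<Rightarrow> (nat \<Rightarrow> nat \<Rightarrow> real) \<Rightarrow> nat \<Rightarrow> real" where
  "separation_radius d s N = 1 / 2 * Min {edist d (s i) (s j) | i j. i < j \<and> j < N}"

text \<open>
  The positivity of the separation radius is spelled out because of \<open>x / 0 = 0\<close>:
  for coinciding points the ratio is to be read as infinite.
\<close>

definition quasi_uniform :: "nat \<Rightarrow> (nat \<Rightarrow> nat \<Rightarrow> real) \<Rightarrow> bool" where
  "quasi_uniform d s \<longleftrightarrow>
     (\<exists>C>0. \<forall>N\<ge>2. separation_radius d s N > 0
                 \<and> covering_radius d s N / separation_radius d s N \<le> C)"

lemma coeff_nat_poly:
  "Polynomial.coeff (nat_poly n :: 'p::prime_card mod_ring poly) i
     = of_nat (n div CARD('p) ^ i mod CARD('p))"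
proof (cases "i < n")
  case True
  then show ?thesis by (simp add: nat_poly_def coeff_sum)
next
  case False
  have "2 \<le> CARD('p)"
    using prime_card[where 'a='p] prime_ge_2_nat by blast
  then have "n < CARD('p) ^ n"
    by (meson le_trans less_exp linorder_not_le power_mono zero_le)
  also have "\<dots> \<le> CARD('p) ^ i"
    using False \<open>2 \<le> CARD('p)\<close> by (intro power_increasing) auto
  finally show ?thesis
    using False by (simp add: nat_poly_def coeff_sum)
qed

lemma degree_badic_digit:
  assumes "degree b \<ge> 1"
  shows "degree (badic_digit b f j) < degree b"
proof -
  have "b \<noteq> 0"
    using assms by auto
  with degree_mod_less[of b "f div b ^ j"] show ?thesis
    using assms by (cases "f div b ^ j mod b = 0") (auto simp: badic_digit_def)
qed

lemma badic_expansion_rem: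
  "f = (\<Sum>j<k. badic_digit b f j * b ^ j) + f div b ^ k * b ^ k"
proof (induction k)
  case (Suc k)
  have "f div b ^ k = f div b ^ k mod b + f div b ^ Suc k * b"
    by (simp add: poly_div_mult_right mult.commute[of b])
  then have "f div b ^ k * b ^ k = badic_digit b f k * b ^ k + f div b ^ Suc k * b ^ Suc k"
    unfolding badic_digit_def by (metis distrib_right mult.assoc power_Suc)
  with Suc show ?case
    by (simp add: add.assoc)
qed simp

lemma badic_expansion:
  assumes "degree b \<ge> 1" and "k > degree f"
  shows "f = (\<Sum>j<k. badic_digit b f j * b ^ j)" and "badic_digit b f k = 0"
proof -
  have "b \<noteq> 0"
    using assms by auto
  then have "degree (b ^ k) = k * degree b"
    by (rule Polynomial.degree_power_eq)
  moreover have "k * 1 \<le> k * degree b"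
    using assms by (intro mult_le_mono) auto
  ultimately have "f div b ^ k = 0"
    using assms by (intro div_poly_less) linarith
  then show "f = (\<Sum>j<k. badic_digit b f j * b ^ j)" and "badic_digit b f k = 0"
    using badic_expansion_rem[of f b k] by (simp_all add: badic_digit_def)
qed

lemma badic_digit_unique:
  fixes a :: "nat \<Rightarrow> 'a::field poly"
  assumes "\<And>j. degree (a j) < degree b" and "f = (\<Sum>j<k. a j * b ^ j)" and "j < k"
  shows "badic_digit b f j = a j"
  using assms
proof (induction k arbitrary: a f j)
  case (Suc k)
  have b: "b \<noteq> 0"
    using Suc.prems(1)[of 0] by auto
  let ?g = "\<Sum>j<k. a (Suc j) * b ^ j"
  have f: "f = a 0 + ?g * b"
    by (simp add: Suc.prems(2) sum.lessThan_Suc_shift sum_distrib_left sum_distrib_right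
        mult_ac del: sum.lessThan_Suc)
  have a0: "a 0 div b = 0" "a 0 mod b = a 0"
    using Suc.prems(1)[of 0] by (simp_all add: div_poly_less mod_poly_less)
  show ?case
  proof (cases j)
    case 0
    then show ?thesis
      using a0 by (simp add: badic_digit_def f)
  next
    case (Suc i)
    have "f div b = ?g"
      using a0 b by (simp add: f)
    then have "badic_digit b f j = badic_digit b ?g i"
      by (simp add: badic_digit_def Suc poly_div_mult_right)
    then show ?thesis
      using Suc.IH[of "\<lambda>j. a (Suc j)" ?g i] Suc.prems(1,3) Suc by simp
  qed
qed simp

end

theory Submission
  imports Defs
begin

text \<open>
  If from some place on the \<open>b\<close>-adic digits of \<open>f\<close> evaluate to \<open>u, 0, 0, \<dots>\<close> and those of \<open>g\<close> to
  \<open>u - 1, p ^ e - 1, p ^ e - 1, \<dots>\<close>, then \<open>\<phi>\<^sub>b(f)\<close> and \<open>\<phi>\<^sub>b(g)\<close> are as close as if all these digits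
  agreed, by the borrow \<open>1000\<dots> - 0999\<dots>\<close>. For \<open>b = X - s\<close> this requires \<open>h = f - g \<equiv> Y ^ j / (1 - Y)\<close> modulo a high power of
  \<open>Y = X - s\<close>, and the Frobenius map yields such \<open>h\<close> of unexpectedly small degree simultaneously
  for all the given bases. This gives two points of \<open>P\<^sub>N\<close> at distance of order \<open>N ^ (- 1 / (d - 1))\<close>,
  whereas the covering radius is at least of order \<open>N ^ (- 1 / d)\<close>.
\<close>

subsection \<open>Digits and closeness of radical inverses\<close>

text \<open>The radical inverse as a function of the polynomial itself, so that close pairs can be
  built by algebra in F_p[X] and turned into indices only at the end.\<close>

definition poly_radical_inverse :: "'p::prime_card mod_ring poly \<Rightarrow> 'p mod_ring poly \<Rightarrow> real" where
  "poly_radical_inverse b f =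
     (\<Sum>j. real_of_int (eval_at_p (badic_digit b f j)) / (real CARD('p) ^ degree b) ^ (j + 1))"

definition radical_prefix :: "'p::prime_card mod_ring poly \<Rightarrow> 'p mod_ring poly \<Rightarrow> nat \<Rightarrow> real" where
  "radical_prefix b f k =
     (\<Sum>j<k. real_of_int (eval_at_p (badic_digit b f j)) / (real CARD('p) ^ degree b) ^ (j + 1))"

lemma two_le_prime_card: "2 \<le> CARD('p::prime_card)"
  using prime_card[where 'a='p] prime_ge_2_nat by blast

lemma to_int_mod_ring_bounds:
  fixes x :: "'p::prime_card mod_ring"
  shows "0 \<le> to_int_mod_ring x" "to_int_mod_ring x < int CARD('p)"
  using range_to_int_mod_ring[where 'a='p] by (metis atLeastLessThan_iff rangeI)+

lemma to_int_mod_ring_minus_one: "to_int_mod_ring (- 1 :: 'p::prime_card mod_ring) = int CARD('p) - 1"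
proof -
  have "of_int_mod_ring (int CARD('p) - 1) = (- 1 :: 'p mod_ring)"
    by (simp flip: of_int_of_int_mod_ring)
  then show ?thesis
    using to_int_mod_ring_of_int_mod_ring[of "int CARD('p) - 1", where 'a='p]
      two_le_prime_card[where 'p='p]
    by simp
qed

lemma eval_at_p_0 [simp]: "eval_at_p 0 = 0"
  by (simp add: eval_at_p_def)

lemma eval_at_p_pCons [simp]:
  "eval_at_p (pCons c a :: 'p::prime_card mod_ring poly) = to_int_mod_ring c + int CARD('p) * eval_at_p a"
  by (cases "c = 0 \<and> a = 0") (auto simp: eval_at_p_def map_poly_pCons)

lemma eval_at_p_one [simp]: "eval_at_p (1 :: 'p::prime_card mod_ring poly) = 1"
  by (simp add: one_pCons)

lemma eval_at_p_minus_one: "eval_at_p (- 1 :: 'p::prime_card mod_ring poly) = int CARD('p) - 1"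
  by (simp add: one_pCons to_int_mod_ring_minus_one)

lemma eval_at_p_bounds:
  fixes a :: "'p::prime_card mod_ring poly"
  assumes "degree a < e"
  shows "0 \<le> eval_at_p a \<and> eval_at_p a \<le> int CARD('p) ^ e - 1"
  using assms
proof (induction e arbitrary: a)
  case (Suc e)
  obtain c a' where a: "a = pCons c a'"
    by (cases a)
  have "a' = 0 \<or> degree a' < e"
    using Suc.prems by (auto simp: a split: if_splits)
  then have "0 \<le> eval_at_p a' \<and> eval_at_p a' \<le> int CARD('p) ^ e - 1"
    using Suc.IH by auto
  moreover from this have "int CARD('p) * eval_at_p a' \<le> int CARD('p) * (int CARD('p) ^ e - 1)"
    by (intro mult_left_mono) auto
  ultimately show ?case
    using to_int_mod_ring_bounds[of c] by (simp add: a algebra_simps)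
qed simp

lemma badic_digit_diff: "badic_digit b (f - g) j = badic_digit b f j - badic_digit b g j"
  by (simp add: badic_digit_def poly_div_diff_left poly_mod_diff_left)

text \<open>Expanding the remainder \<open>r\<close> in base \<open>b\<close> as well completes the
  sum to a full finite expansion, to which uniqueness of digits applies. Hence a congruence modulo
  \<open>b ^ k\<close> already determines the first \<open>k\<close> digits.\<close>

lemma badic_digit_eqI:
  fixes a :: "nat \<Rightarrow> 'a::field poly"
  assumes deg: "degree b \<ge> 1" "\<And>j. j < k \<Longrightarrow> degree (a j) < degree b"
    and f: "f = (\<Sum>j<k. a j * b ^ j) + r * b ^ k" and "j < k"
  shows "badic_digit b f j = a j"
proof -
  define M where "M = Suc (degree r)"
  define c where "c i = (if i < k then a i else badic_digit b r (i - k))" for i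
  have "f = (\<Sum>j<k. a j * b ^ j) + (\<Sum>i<M. badic_digit b r i * b ^ i) * b ^ k"
    using badic_expansion(1)[of b r M] deg f by (simp add: M_def)
  also have "\<dots> = (\<Sum>j<k. c j * b ^ j) + (\<Sum>i<M. c (i + k) * b ^ (i + k))"
    by (simp add: c_def sum_distrib_right power_add mult.assoc)
  also have "(\<Sum>i<M. c (i + k) * b ^ (i + k)) = (\<Sum>j\<in>{k..<M + k}. c j * b ^ j)"
    using sum.shift_bounds_nat_ivl[of "\<lambda>j. c j * b ^ j" 0 k M] by (simp add: lessThan_atLeast0)
  also have "(\<Sum>j<k. c j * b ^ j) + \<dots> = (\<Sum>j<M + k. c j * b ^ j)"
    by (simp add: lessThan_atLeast0 sum.atLeastLessThan_concat)
  finally have "badic_digit b f j = c j"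
    using deg degree_badic_digit[of b r] \<open>j < k\<close>
    by (intro badic_digit_unique[where k = "M + k"]) (auto simp: c_def)
  then show ?thesis
    using \<open>j < k\<close> by (simp add: c_def)
qed

text \<open>Each digit value lies between 0 and Q - 1, and (Q - 1) / Q ^ (m + 1) = 1 / Q ^ m - 1 / Q
  ^ (m + 1) telescopes. Keeping the term - 1 / Q ^ m makes the induction close.\<close>

lemma radical_prefix_bounds:
  fixes b :: "'p::prime_card mod_ring poly"
  assumes "degree b \<ge> 1" "k \<le> m"
  defines "Q \<equiv> real CARD('p) ^ degree b"
  shows "radical_prefix b f k \<le> radical_prefix b f m \<and>
         radical_prefix b f m \<le> radical_prefix b f k + 1 / Q ^ k - 1 / Q ^ m"
  using \<open>k \<le> m\<close>
proof (induction m rule: dec_induct)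
  case (step m)
  have Q: "Q > 0"
    using two_le_prime_card[where 'p='p] by (simp add: Q_def)
  define x where "x = real_of_int (eval_at_p (badic_digit b f m))"
  have "0 \<le> x"
    using eval_at_p_bounds[OF degree_badic_digit[OF assms(1)], of f m] by (simp add: x_def)
  have "x \<le> real_of_int (int CARD('p) ^ degree b - 1)"
    using eval_at_p_bounds[OF degree_badic_digit[OF assms(1)], of f m] by (simp only: x_def of_int_le_iff)
  then have "x \<le> Q - 1"
    by (simp add: Q_def)
  then have "x / Q ^ (m + 1) \<le> (Q - 1) / Q ^ (m + 1)"
    using Q by (intro divide_right_mono) auto
  also have "\<dots> = 1 / Q ^ m - 1 / Q ^ (Suc m)"
    using Q by (simp add: field_simps)
  finally have "x / Q ^ (m + 1) \<le> 1 / Q ^ m - 1 / Q ^ (Suc m)" .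
  moreover have "radical_prefix b f (Suc m) = radical_prefix b f m + x / Q ^ (m + 1)"
    by (simp add: radical_prefix_def x_def Q_def)
  moreover have "0 \<le> x / Q ^ (m + 1)"
    using \<open>0 \<le> x\<close> Q by simp
  ultimately show ?case
    using step.IH by linarith
qed simp

lemma poly_radical_inverse_eq_prefix:
  fixes b :: "'p::prime_card mod_ring poly"
  assumes "degree b \<ge> 1" "degree f < m"
  shows "poly_radical_inverse b f = radical_prefix b f m"
  unfolding poly_radical_inverse_def radical_prefix_def
  using assms by (intro suminf_finite) (auto simp: badic_expansion(2))

text \<open>The digits from position \<open>k\<close> on add between 0 and 1 / Q ^ k to either side.
  The hypothesis leaves room for a gap of 1 / Q ^ k between the prefixes, which is exactly what an
  unfinished borrow produces.\<close>

lemma poly_radical_inverse_diff_le: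
  fixes b :: "'p::prime_card mod_ring poly"
  assumes "degree b \<ge> 1"
  defines "Q \<equiv> real CARD('p) ^ degree b"
  assumes "\<bar>radical_prefix b f k - radical_prefix b g k\<bar> \<le> 1 / Q ^ k"
  shows "\<bar>poly_radical_inverse b f - poly_radical_inverse b g\<bar> \<le> 2 / Q ^ k"
proof -
  define m where "m = k + Suc (degree f + degree g)"
  have "1 / Q ^ m \<ge> 0"
    using two_le_prime_card[where 'p='p] by (simp add: Q_def)
  moreover have "k \<le> m" "degree f < m" "degree g < m"
    by (simp_all add: m_def)
  moreover have "2 / Q ^ k = 1 / Q ^ k + 1 / Q ^ k"
    by simp
  ultimately show ?thesis
    using radical_prefix_bounds[OF assms(1) \<open>k \<le> m\<close>, of f] radical_prefix_bounds[OF assms(1) \<open>k \<le> m\<close>, of g]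
      poly_radical_inverse_eq_prefix[OF assms(1), of f m]
      poly_radical_inverse_eq_prefix[OF assms(1), of g m] assms(3)
    unfolding Q_def by linarith
qed

lemma poly_radical_inverse_close_agree:
  fixes b :: "'p::prime_card mod_ring poly"
  assumes "degree b \<ge> 1" "\<And>j. j < k \<Longrightarrow> badic_digit b f j = badic_digit b g j"
  shows "\<bar>poly_radical_inverse b f - poly_radical_inverse b g\<bar> \<le> 2 / (real CARD('p) ^ degree b) ^ k"
  using assms by (intro poly_radical_inverse_diff_le) (auto simp: radical_prefix_def)

lemma poly_radical_inverse_close_carry:
  fixes b :: "'p::prime_card mod_ring poly"
  assumes "degree b \<ge> 1" "J < k"
    and agree: "\<And>j. j < J \<Longrightarrow> badic_digit b f j = badic_digit b g j"
    and lead: "eval_at_p (badic_digit b f J) = eval_at_p (badic_digit b g J) + 1"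
    and tail: "\<And>j. J < j \<Longrightarrow> j < k \<Longrightarrow> badic_digit b f j = 0"
      "\<And>j. J < j \<Longrightarrow> j < k \<Longrightarrow> eval_at_p (badic_digit b g j) = int CARD('p) ^ degree b - 1"
  shows "\<bar>poly_radical_inverse b f - poly_radical_inverse b g\<bar> \<le> 2 / (real CARD('p) ^ degree b) ^ k"
proof -
  define Q where "Q = real CARD('p) ^ degree b"
  have Q: "Q > 0"
    using two_le_prime_card[where 'p='p] by (simp add: Q_def)
  \<comment> \<open>Invariant of the borrow: the gap starts as one unit of position
    \<open>J\<close>, and each further maximal digit of \<open>g\<close> shrinks it to one unit of
    the next position.\<close>
  have "radical_prefix b f m - radical_prefix b g m = 1 / Q ^ m" if "Suc J \<le> m" "m \<le> k" for m
    using that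
  proof (induction m rule: dec_induct)
    case base
    have "radical_prefix b f J = radical_prefix b g J"
      using agree by (simp add: radical_prefix_def)
    then show ?case
      by (simp add: radical_prefix_def lead Q_def add_divide_distrib)
  next
    case (step m)
    have "radical_prefix b f (Suc m) = radical_prefix b f m"
      using tail(1)[of m] step by (simp add: radical_prefix_def)
    moreover have "radical_prefix b g (Suc m) = radical_prefix b g m + (Q - 1) / Q ^ Suc m"
      using tail(2)[of m] step by (simp add: radical_prefix_def Q_def)
    moreover have "1 / Q ^ m - (Q - 1) / Q ^ Suc m = 1 / Q ^ Suc m"
      using Q by (simp add: field_simps)
    ultimately show ?case
      using step by simp
  qed
  then show ?thesis
    using assms(1,2) Q by (intro poly_radical_inverse_diff_le) (simp_all add: Q_def)
qed

section \<open>From polynomials to points of the sequence\<close>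

lemma ex_nat_poly:
  fixes f :: "'p::prime_card mod_ring poly"
  assumes "degree f < K"
  shows "\<exists>n < CARD('p) ^ K. nat_poly n = f"
proof -
  have "\<exists>n < CARD('p) ^ K. nat_poly n = f" if "degree f < K \<or> f = 0" for K and f :: "'p mod_ring poly"
    using that
  proof (induction K arbitrary: f)
    case 0
    then show ?case
      by (intro exI[of _ 0]) (auto simp: nat_poly_def)
  next
    case (Suc K)
    obtain c f' where f: "f = pCons c f'"
      by (cases f)
    have "degree f' < K \<or> f' = 0"
      using Suc.prems by (auto simp: f split: if_splits)
    then obtain n where n: "n < CARD('p) ^ K" "nat_poly n = f'"
      using Suc.IH by blast
    obtain i where i: "i < CARD('p)" "c = of_nat i"
      using surj_of_nat_mod_ring[of c] by blast
    have "i + CARD('p) * n < CARD('p) ^ Suc K"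
    proof -
      have "i + CARD('p) * n < CARD('p) * Suc n"
        using i by simp
      also have "\<dots> \<le> CARD('p) * CARD('p) ^ K"
        using n by (intro mult_le_mono2) simp
      finally show ?thesis
        by simp
    qed
    moreover have "nat_poly (i + CARD('p) * n) = f"
    proof (rule poly_eqI)
      fix t
      show "Polynomial.coeff (nat_poly (i + CARD('p) * n)) t = Polynomial.coeff f t"
      proof (cases t)
        case 0
        then show ?thesis
          using i by (simp add: coeff_nat_poly f)
      next
        case (Suc t')
        have "(i + CARD('p) * n) div CARD('p) ^ t = n div CARD('p) ^ t'"
          using i by (simp add: Suc div_mult2_eq)
        then show ?thesis
          using n(2) coeff_nat_poly[of n t', where 'p='p] by (simp add: coeff_nat_poly f Suc)
      qed
    qed
    ultimately show ?case
      by blast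
  qed
  then show ?thesis
    using assms by blast
qed

text \<open>Degree less than \<open>K\<close> puts both points among the first p ^ K, and bounding
  the Euclidean norm by the sum of the coordinates costs the factor \<open>d\<close>.\<close>

lemma halton_close_pair:
  fixes b :: "nat \<Rightarrow> 'p::prime_card mod_ring poly"
  assumes "f \<noteq> g" "degree f < K" "degree g < K"
    and close: "\<And>i. i \<in> {1..d} \<Longrightarrow> \<bar>poly_radical_inverse (b i) f - poly_radical_inverse (b i) g\<bar> \<le> e"
  shows "\<exists>i j. i < j \<and> j < CARD('p) ^ K \<and> edist d (halton b i) (halton b j) \<le> real d * e"
proof -
  obtain n m where n: "n < CARD('p) ^ K" "nat_poly n = f" and m: "m < CARD('p) ^ K" "nat_poly m = g"
    using ex_nat_poly assms(2,3) by metis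
  have halton: "halton b n i = poly_radical_inverse (b i) f" "halton b m i = poly_radical_inverse (b i) g" for i
    by (simp_all add: halton_def radical_inverse_def poly_radical_inverse_def n m)
  have "edist d (halton b n) (halton b m) \<le> (\<Sum>i\<in>{1..d}. \<bar>halton b n i - halton b m i\<bar>)"
    unfolding edist_def by (rule L2_set_le_sum_abs)
  also have "\<dots> \<le> (\<Sum>i\<in>{1..d}. e)"
    using close by (intro sum_mono) (simp add: halton)
  finally have le: "edist d (halton b n) (halton b m) \<le> real d * e"
    by simp
  moreover have "edist d (halton b m) (halton b n) = edist d (halton b n) (halton b m)"
    by (simp add: edist_def L2_set_def power2_commute)
  moreover have "n \<noteq> m"
    using \<open>f \<noteq> g\<close> n m by blast
  ultimately show ?thesis
    using n m by (metis linorder_neqE_nat)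
qed

subsection \<open>Separation and covering radius\<close>

lemma separation_radius_le:
  assumes "i < j" "j < N" "edist d (s i) (s j) \<le> e"
  shows "separation_radius d s N \<le> e / 2"
proof -
  have "{edist d (s i) (s j) | i j. i < j \<and> j < N} \<subseteq> (\<lambda>(i, j). edist d (s i) (s j)) ` ({..<N} \<times> {..<N})"
    by auto
  then have "finite {edist d (s i) (s j) | i j. i < j \<and> j < N}"
    by (rule finite_subset) simp
  then have "Min {edist d (s i) (s j) | i j. i < j \<and> j < N} \<le> edist d (s i) (s j)"
    using assms by (intro Min_le) auto
  then show ?thesis
    using assms by (simp add: separation_radius_def)
qed

text \<open>Pigeonhole: one of the \<open>M ^ d\<close> cells of the unit cube contains no point; take its midpoint.\<close>

lemma covering_radius_ge:
  fixes s :: "nat \<Rightarrow> nat \<Rightarrow> real"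
  assumes "M ^ d > N" "N \<ge> 1" "d \<ge> 1"
  shows "1 / (2 * real M) \<le> covering_radius d s N"
proof -
  have M: "M > 0"
    using assms by (cases M) (auto simp: power_0_left)
  \<comment> \<open>The points of \<open>s\<close> are arbitrary reals, so a cell index may leave
    \<open>{..<M}\<close> or be truncated to 0 by \<open>nat\<close>; the count and the distance
    estimate below hold in that case too.\<close>
  define cell where "cell i = (\<lambda>k\<in>{1..d}. nat \<lfloor>real M * s i k\<rfloor>)" for i
  have "card (cell ` {..<N}) < card ({1..d} \<rightarrow>\<^sub>E {..<M})"
    using assms card_image_le[of "{..<N}" cell] by (simp add: card_PiE)
  then have "\<not> ({1..d} \<rightarrow>\<^sub>E {..<M}) \<subseteq> cell ` {..<N}"
    by (meson card_mono finite_imageI finite_lessThan linorder_not_less)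
  then obtain v where v: "v \<in> {1..d} \<rightarrow>\<^sub>E {..<M}" "v \<notin> cell ` {..<N}"
    by blast
  define x where "x = (\<lambda>k\<in>{1..d}. (real (v k) + 1 / 2) / real M)"
  have x: "x \<in> {1..d} \<rightarrow>\<^sub>E {0..1}"
  proof (intro PiE_I)
    fix k assume k: "k \<in> {1..d}"
    then have "v k < M"
      using v by blast
    then have "real (v k) + 1 \<le> real M"
      by linarith
    then show "x k \<in> {0..1}"
      using M k by (simp add: x_def field_simps)
  qed (auto simp: x_def)
  have far: "1 / (2 * real M) \<le> edist d x (s i)" if "i < N" for i
  proof -
    have "cell i \<noteq> v"
      using v that by blast
    moreover have "cell i \<in> extensional {1..d}" "v \<in> extensional {1..d}"
      using v by (auto simp: cell_def PiE_def)
    ultimately obtain k where "k \<in> {1..d}" "cell i k \<noteq> v k"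
      using extensionalityI[of "cell i" "{1..d}" v] by blast
    then have k: "k \<in> {1..d}" "nat \<lfloor>real M * s i k\<rfloor> \<noteq> v k"
      by (simp_all add: cell_def)
    have "1 / 2 \<le> \<bar>real (v k) + 1 / 2 - real M * s i k\<bar>"
      using k(2) by linarith
    also have "real (v k) + 1 / 2 - real M * s i k = real M * (x k - s i k)"
      using M k by (simp add: x_def right_diff_distrib)
    also have "\<bar>\<dots>\<bar> = real M * \<bar>x k - s i k\<bar>"
      by (simp add: abs_mult)
    finally have "1 / (2 * real M) \<le> \<bar>x k - s i k\<bar>"
      using M by (simp add: field_simps)
    also have "\<dots> \<le> L2_set (\<lambda>k. \<bar>x k - s i k\<bar>) {1..d}"
      using k by (intro member_le_L2_set) auto
    also have "\<dots> = edist d x (s i)"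
      by (simp add: edist_def L2_set_def)
    finally show ?thesis .
  qed
  have "1 / (2 * real M) \<le> Min ((\<lambda>i. edist d x (s i)) ` {..<N})"
    using far assms by (subst Min_ge_iff) (auto simp: lessThan_empty_iff)
  also have "\<dots> \<le> covering_radius d s N"
    unfolding covering_radius_def
  \<comment> \<open>A supremum of reals is an upper bound only for a bounded set; here the distance
    to \<open>s 0\<close> alone is bounded uniformly over the cube.\<close>
  proof (intro cSUP_upper x bdd_aboveI2)
    fix y :: "nat \<Rightarrow> real" assume y: "y \<in> {1..d} \<rightarrow>\<^sub>E {0..1}"
    have "Min ((\<lambda>i. edist d y (s i)) ` {..<N}) \<le> edist d y (s 0)"
      using assms by (intro Min_le) auto
    also have "\<dots> \<le> (\<Sum>k\<in>{1..d}. \<bar>y k - s 0 k\<bar>)"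
      unfolding edist_def by (rule L2_set_le_sum_abs)
    also have "\<dots> \<le> (\<Sum>k\<in>{1..d}. 1 + \<bar>s 0 k\<bar>)"
    proof (intro sum_mono)
      fix k assume "k \<in> {1..d}"
      then have "y k \<in> {0..1}"
        using y by blast
      then show "\<bar>y k - s 0 k\<bar> \<le> 1 + \<bar>s 0 k\<bar>"
        by auto
    qed
    finally show "Min ((\<lambda>i. edist d y (s i)) ` {..<N}) \<le> (\<Sum>k\<in>{1..d}. 1 + \<bar>s 0 k\<bar>)" .
  qed
  finally show ?thesis .
qed

lemma covering_radius_ge_powr:
  assumes "N \<ge> 1" "d \<ge> 1"
  shows "1 / (4 * real N powr (1 / real d)) \<le> covering_radius d s N"
proof -
  define r where "r = real N powr (1 / real d)"
  \<comment> \<open>Just above \<open>r\<close>, so that M ^ d exceeds r ^ d = N, yet at most 2 * r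
    because r is at least 1; hence the constant 4.\<close>
  define M where "M = nat \<lfloor>r\<rfloor> + 1"
  have r: "r \<ge> 1"
    using assms by (simp add: r_def ge_one_powr_ge_zero)
  have "real N = r ^ d"
    using assms by (simp add: r_def powr_powr flip: powr_realpow)
  also have "\<dots> < real M ^ d"
    using r assms by (intro power_strict_mono) (auto simp: M_def, linarith)
  finally have "N < M ^ d"
    by (metis of_nat_less_iff of_nat_power)
  moreover have "1 / (4 * r) \<le> 1 / (2 * real M)"
  proof -
    have "real M \<le> 2 * r"
      using r unfolding M_def by linarith
    moreover have "real M > 0"
      by (simp add: M_def)
    ultimately show ?thesis
      using r by (intro divide_left_mono) auto
  qed
  ultimately show ?thesis
    using covering_radius_ge[of N M d s] assms by (simp add: r_def)
qed

text \<open>The covering radius is at least N ^ (- 1 / d) / 4 by pigeonhole, so at the given N the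
  ratio is at least N ^ \<alpha> / (4 * c) with \<alpha> = 1 / (d - 1) - 1 / d > 0, which is
  unbounded.\<close>

lemma small_separation_not_quasi_uniform:
  fixes s :: "nat \<Rightarrow> nat \<Rightarrow> real"
  assumes "d \<ge> 2" "c > 0"
    and inf: "infinite {N. separation_radius d s N \<le> c / real N powr (1 / (real d - 1))}"
  shows "\<not> quasi_uniform d s"
proof
  assume "quasi_uniform d s"
  then obtain C where C: "C > 0" and sep: "\<And>N. N \<ge> 2 \<Longrightarrow> separation_radius d s N > 0"
    and ratio: "\<And>N. N \<ge> 2 \<Longrightarrow> covering_radius d s N / separation_radius d s N \<le> C"
    unfolding quasi_uniform_def by blast
  define \<alpha> where "\<alpha> = 1 / (real d - 1) - 1 / real d"
  have \<alpha>: "\<alpha> > 0"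
    using assms(1) by (simp add: \<alpha>_def field_simps)
  define B where "B = nat \<lceil>(4 * C * c) powr (1 / \<alpha>)\<rceil> + 2"
  obtain N where N: "N > B" "separation_radius d s N \<le> c / real N powr (1 / (real d - 1))"
    using inf unfolding infinite_nat_iff_unbounded by blast
  have N2: "N \<ge> 2" "real N > (4 * C * c) powr (1 / \<alpha>)"
    using N(1) unfolding B_def by linarith+
  have "1 / (4 * real N powr (1 / real d)) \<le> covering_radius d s N"
    using N2 assms(1) by (intro covering_radius_ge_powr) auto
  also have "\<dots> \<le> C * separation_radius d s N"
    using ratio[of N] sep[of N] N2 by (simp add: pos_divide_le_eq)
  also have "\<dots> \<le> C * (c / real N powr (1 / (real d - 1)))"
    using N C by (intro mult_left_mono) auto
  finally have "real N powr (1 / (real d - 1)) / real N powr (1 / real d) \<le> 4 * C * c"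
    using N2 by (simp add: field_simps)
  then have "real N powr \<alpha> \<le> 4 * C * c"
    by (simp add: \<alpha>_def powr_diff)
  then have "(real N powr \<alpha>) powr (1 / \<alpha>) \<le> (4 * C * c) powr (1 / \<alpha>)"
    using \<alpha> by (intro powr_mono2) auto
  then show False
    using N2 \<alpha> by (simp add: powr_powr)
qed

lemma small_separation:
  fixes s :: "nat \<Rightarrow> nat \<Rightarrow> real"
  assumes "d \<ge> 2" "c > 0"
    and close: "\<And>m. \<exists>N>m. \<exists>i j. i < j \<and> j < N \<and>
      edist d (s i) (s j) \<le> c / real N powr (1 / (real d - 1))"
  shows "(\<exists>c>0. infinite {N. separation_radius d s N \<le> c / real N powr (1 / (real d - 1))})
    \<and> \<not> quasi_uniform d s"
proof -
  \<comment> \<open>The constant drops to c / 2 because the separation radius is half the minimal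
    distance.\<close>
  have "infinite {N. separation_radius d s N \<le> (c / 2) / real N powr (1 / (real d - 1))}"
    unfolding infinite_nat_iff_unbounded
  proof
    fix m
    obtain N i j where "N > m" "i < j" "j < N"
      "edist d (s i) (s j) \<le> c / real N powr (1 / (real d - 1))"
      using close by blast
    then show "\<exists>n>m. n \<in> {N. separation_radius d s N \<le> (c / 2) / real N powr (1 / (real d - 1))}"
      using separation_radius_le[of i j N d s] by force
  qed
  moreover have "c / 2 > 0"
    using assms by simp
  ultimately show ?thesis
    using small_separation_not_quasi_uniform[OF assms(1)] by blast
qed

subsection \<open>Close pairs in the three Halton-type sequences\<close>

lemma badic_digit_power_mult:
  assumes "degree b \<ge> 1"
  shows "badic_digit b (b ^ m * f) j = (if j < m then 0 else badic_digit b f (j - m))"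
proof -
  have b: "b \<noteq> 0"
    using assms by auto
  show ?thesis
  proof (cases "j < m")
    case True
    then have "b ^ m = b ^ j * (b * b ^ (m - j - 1))"
      by (simp flip: power_Suc power_add)
    then have eq: "b ^ m * f = b ^ j * (b * (b ^ (m - j - 1) * f))"
      by (simp only: mult.assoc)
    show ?thesis
      unfolding badic_digit_def eq using True b by simp
  next
    case False
    then have "b ^ j = b ^ m * b ^ (j - m)"
      by (simp flip: power_add)
    then show ?thesis
      using False b by (simp add: badic_digit_def)
  qed
qed

lemma badic_digit_degree_less:
  assumes "degree f < degree b"
  shows "badic_digit b f j = (if j = 0 then f else 0)"
proof (cases j)
  case 0
  then show ?thesis
    using assms by (simp add: badic_digit_def mod_poly_less)
next
  case (Suc i)
  have "b \<noteq> 0"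
    using assms by auto
  then have "degree (b ^ j) = degree b + i * degree b"
    unfolding Suc by (subst Polynomial.degree_power_eq) simp_all
  then have "degree f < degree (b ^ j)"
    using assms by simp
  then show ?thesis
    using Suc by (simp add: badic_digit_def div_poly_less)
qed

text \<open>The leading terms cancel, so f - g is zero or of smaller degree than \<open>g\<close>
  and contributes nothing to the quotient. This yields the top digit of X ^ (J - 1) in every base X
  - s.\<close>

lemma monic_div_eq_1:
  fixes f g :: "'a::field poly"
  assumes "lead_coeff f = 1" "lead_coeff g = 1" "degree f = degree g"
  shows "f div g = 1"
proof -
  have g: "g \<noteq> 0"
    using assms(2) by auto
  have "f - g = 0 \<or> degree (f - g) < degree g"
  proof (rule ccontr)
    assume *: "\<not> ?thesis"
    then have "degree (f - g) = degree g"
      using degree_diff_le[of f "degree g" g] assms by force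
    moreover have "Polynomial.coeff (f - g) (degree g) = 0"
      using assms by simp
    ultimately show False
      using * by (metis leading_coeff_0_iff)
  qed
  then have "(f - g) div g = 0"
    by (auto simp: div_poly_less)
  moreover have "(g + (f - g)) div g = 1 + (f - g) div g"
    unfolding poly_div_add_left using g by simp
  ultimately show ?thesis
    by simp
qed

lemma frobenius_poly:
  fixes x y :: "'p::prime_card mod_ring poly"
  shows frobenius_poly_add: "(x + y) ^ CARD('p) ^ n = x ^ CARD('p) ^ n + y ^ CARD('p) ^ n"
    and frobenius_poly_diff: "(x - y) ^ CARD('p) ^ n = x ^ CARD('p) ^ n - y ^ CARD('p) ^ n"
proof -
  show add: "(x + y) ^ CARD('p) ^ n = x ^ CARD('p) ^ n + y ^ CARD('p) ^ n" for x y :: "'p mod_ring poly"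
    using prime_card[where 'a='p] by (intro freshmans_dream') simp_all
  show "(x - y) ^ CARD('p) ^ n = x ^ CARD('p) ^ n - y ^ CARD('p) ^ n"
    using add[of "x - y" y] by simp
qed

text \<open>Fermat's little theorem, iterated: the map is additive and fixes 1, hence fixes every
  \<open>of_nat i\<close>, and these exhaust the field.\<close>

lemma frobenius_mod_ring:
  fixes c :: "'p::prime_card mod_ring"
  shows "c ^ CARD('p) ^ n = c"
proof -
  have "(of_nat i :: 'p mod_ring) ^ CARD('p) ^ n = of_nat i" for i
  proof (induction i)
    case (Suc i)
    have "(1 + of_nat i :: 'p mod_ring) ^ CARD('p) ^ n = 1 ^ CARD('p) ^ n + of_nat i ^ CARD('p) ^ n"
      using prime_card[where 'a='p] by (intro freshmans_dream') simp_all
    then show ?case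
      using Suc by simp
  qed (simp add: power_0_left)
  then show ?thesis
    using surj_of_nat_mod_ring[of c] by blast
qed

lemma frobenius_const:
  "[:c:] ^ CARD('p) ^ n = [:c :: 'p::prime_card mod_ring:]"
  by (simp add: poly_const_pow frobenius_mod_ring)

text \<open>With r = d - 1 and N = p ^ (r * k) this evaluates N ^ (1 / (d - 1)).\<close>

lemma power_powr_inverse:
  assumes "r \<ge> 1" "p \<ge> 1"
  shows "real (p ^ (r * k)) powr (1 / real r) = real p ^ k"
proof -
  have "real (p ^ (r * k)) = (real p ^ k) powr real r"
    using assms by (simp add: powr_realpow mult.commute flip: power_mult)
  then show ?thesis
    using assms by (simp add: powr_powr)
qed

lemma power_pred_mult: "1 \<le> n \<Longrightarrow> x * x ^ (n - 1) = x ^ n" for x :: "'a::monoid_mult"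
  by (cases n) auto

lemma divide_power_pred: "1 \<le> n \<Longrightarrow> x \<noteq> 0 \<Longrightarrow> y / x ^ (n - 1) = y * x / x ^ n" for x :: real
  by (cases n) auto

text \<open>With \<open>Y = X + a\<close> and \<open>Z = Y + 1\<close>, the polynomials \<open>1\<close> and \<open>1 - Y ^ (q - 1)\<close> agree to high
  order at \<open>Y\<close>, while \<open>Y ^ (q - 1) = (Z ^ q - 1) / (Z - 1) = 1 + Z + \<dots> + Z ^ (q - 1)\<close> causes a
  full borrow at \<open>Z\<close>.\<close>

lemma halton_close_two_linear:
  fixes b :: "nat \<Rightarrow> 'p::prime_card mod_ring poly"
  assumes b: "b 1 = [:a, 1:]" "b 2 = [:a + 1, 1:]" and q_def: "q = CARD('p) ^ n"
  shows "\<exists>i j. i < j \<and> j < CARD('p) ^ q \<and>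
    edist 2 (halton b i) (halton b j) \<le> 4 * real CARD('p) / real CARD('p) ^ q"
proof -
  define p where "p = real CARD('p)"
  have p: "p \<ge> 2"
    using two_le_prime_card[where 'p='p] by (simp add: p_def)
  have q: "q \<ge> 1"
    using two_le_prime_card[where 'p='p] by (simp add: q_def)
  define Y where "Y = [:a, 1:]"
  define Z where "Z = [:a + 1, 1:]"
  have deg: "degree Y = 1" "degree Z = 1"
    by (simp_all add: Y_def Z_def)
  have YZ: "Y = Z - 1"
    by (simp add: Y_def Z_def one_pCons)
  \<comment> \<open>Y ^ q = Z ^ q - 1 by Frobenius; factoring the right-hand side as Z - 1 times a
    geometric sum allows Y = Z - 1 to be cancelled.\<close>
  have "Y * Y ^ (q - 1) = Y ^ q"
    using q by (rule power_pred_mult)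
  also have "\<dots> = Z ^ q - 1"
    using frobenius_poly_diff[of Z 1 n] by (simp add: YZ q_def)
  also have "\<dots> = Y * (\<Sum>t<q. Z ^ t)"
    by (simp add: YZ power_diff_1_eq)
  finally have sum: "Y ^ (q - 1) = (\<Sum>t<q. Z ^ t)"
    using deg by (metis degree_0 mult_cancel_left zero_neq_one)
  have digit_Y: "badic_digit Y (Y ^ (q - 1)) j = 0" if "j < q - 1" for j
    using badic_digit_power_mult[of Y "q - 1" 1 j] that deg by simp
  have digit_Z: "badic_digit Z (Y ^ (q - 1)) j = 1" if "j < q" for j
    using that deg sum by (intro badic_digit_eqI[where k = q and r = 0]) auto
  have digit_1: "badic_digit Z 1 j = (if j = 0 then 1 else 0)" for j
    using deg by (intro badic_digit_degree_less) simp
  have "\<bar>poly_radical_inverse Y 1 - poly_radical_inverse Y (1 - Y ^ (q - 1))\<bar>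
      \<le> 2 / (real CARD('p) ^ degree Y) ^ (q - 1)"
    using deg by (intro poly_radical_inverse_close_agree) (simp_all add: badic_digit_diff digit_Y [simplified])
  \<comment> \<open>Only q - 1 digits are known to agree here, which costs a factor
    \<open>p\<close>.\<close>
  then have close_Y: "\<bar>poly_radical_inverse Y 1 - poly_radical_inverse Y (1 - Y ^ (q - 1))\<bar> \<le> 2 * p / p ^ q"
    using q p divide_power_pred[of q p 2] by (simp add: deg p_def)
  \<comment> \<open>In base \<open>Z\<close> the first q digits are 1, 0, 0, ... for 1 and 0, -1,
    -1, ... for 1 - Y ^ (q - 1), and -1 evaluates to p - 1: a borrow from position 0.\<close>
  have "\<bar>poly_radical_inverse Z 1 - poly_radical_inverse Z (1 - Y ^ (q - 1))\<bar>
      \<le> 2 / (real CARD('p) ^ degree Z) ^ q"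
    using deg q by (intro poly_radical_inverse_close_carry[where J = 0])
      (simp_all add: badic_digit_diff digit_Z [simplified] digit_1 eval_at_p_minus_one)
  then have close_Z: "\<bar>poly_radical_inverse Z 1 - poly_radical_inverse Z (1 - Y ^ (q - 1))\<bar> \<le> 2 * p / p ^ q"
  proof (rule order_trans)
    show "2 / (real CARD('p) ^ degree Z) ^ q \<le> 2 * p / p ^ q"
      using p by (simp add: deg p_def divide_right_mono)
  qed
  have "\<bar>poly_radical_inverse (b i) 1 - poly_radical_inverse (b i) (1 - Y ^ (q - 1))\<bar>
      \<le> 2 * p / p ^ q" if "i \<in> {1..2}" for i
  proof -
    have "i = 1 \<or> i = 2"
      using that by auto
    then show ?thesis
      using b close_Y close_Z by (auto simp: Y_def Z_def)
  qed
  moreover have "Y ^ (q - 1) \<noteq> 0"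
    using deg by auto
  moreover have "degree (Y ^ (q - 1)) < q"
    using q deg degree_power_le[of Y "q - 1"] by simp
  moreover from this have "degree (1 - Y ^ (q - 1)) < q"
    using q by (intro degree_diff_less) auto
  ultimately have "\<exists>i j. i < j \<and> j < CARD('p) ^ q \<and>
      edist 2 (halton b i) (halton b j) \<le> real 2 * (2 * p / p ^ q)"
    using q by (intro halton_close_pair[where f = 1 and g = "1 - Y ^ (q - 1)"]) auto
  then show ?thesis
    by (simp add: p_def)
qed

text \<open>Here \<open>X * (X + 1) = b 3 - 1\<close>, so that \<open>h = X ^ (m - 1) * (X + 1) ^ m = (b 3 ^ m - 1) / X\<close> is
  also \<open>(X + 1) * (1 + b 3 + \<dots> + b 3 ^ (m - 1))\<close>; the digit \<open>X + 1\<close> evaluates to the maximal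
  value \<open>3\<close>.\<close>

lemma halton_close_quadratic:
  fixes b :: "nat \<Rightarrow> 'p::prime_card mod_ring poly"
  assumes card: "CARD('p) = 2" and b: "b 1 = [:0, 1:]" "b 2 = [:1, 1:]" "b 3 = [:1, 1, 1:]"
    and m_def: "m = 2 ^ n"
  shows "\<exists>i j. i < j \<and> j < 2 ^ (2 * m) \<and> edist 3 (halton b i) (halton b j) \<le> 12 / 2 ^ m"
proof -
  have m: "m \<ge> 1"
    by (simp add: m_def)
  define X :: "'p mod_ring poly" where "X = [:0, 1:]"
  define Z :: "'p mod_ring poly" where "Z = [:1, 1:]"
  define B :: "'p mod_ring poly" where "B = [:1, 1, 1:]"
  define h where "h = X ^ (m - 1) * Z ^ m"
  have deg: "degree X = 1" "degree Z = 1" "degree B = 2"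
    by (simp_all add: X_def Z_def B_def)
  have minus1: "to_int_mod_ring (- 1 :: 'p mod_ring) = 1"
    using to_int_mod_ring_minus_one[where 'p='p] card by simp
  have XZ: "X * Z = B - 1"
    by (simp add: X_def Z_def B_def one_pCons)
  \<comment> \<open>The exponent of \<open>X\<close> in \<open>h\<close> is one less than that of
    \<open>Z\<close>, so that X * h is a full m-th power to which Frobenius applies; cancelling
    \<open>X\<close> then leaves the digit \<open>Z\<close> at every position.\<close>
  have "X * h = (X * Z) ^ m"
    using power_pred_mult[OF m, of X] by (simp add: h_def power_mult_distrib flip: mult.assoc)
  also have "\<dots> = B ^ m - 1"
    using frobenius_poly_diff[of B 1 n] by (simp add: XZ m_def card)
  also have "\<dots> = X * (\<Sum>t<m. Z * B ^ t)"
    by (simp add: power_diff_1_eq XZ [symmetric] sum_distrib_left mult.assoc)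
  finally have h_B: "h = (\<Sum>t<m. Z * B ^ t)"
    using deg by (metis degree_0 mult_cancel_left zero_neq_one)
  have digit_X: "badic_digit X h j = 0" if "j < m - 1" for j
    using badic_digit_power_mult[of X "m - 1" "Z ^ m" j] that deg by (simp add: h_def)
  have digit_Z: "badic_digit Z h j = 0" if "j < m" for j
    using badic_digit_power_mult[of Z m "X ^ (m - 1)" j] that deg by (simp add: h_def mult.commute)
  have digit_B: "badic_digit B h j = Z" if "j < m" for j
    using that deg h_B by (intro badic_digit_eqI[where k = m and r = 0]) auto
  have digit_f: "badic_digit B X j = (if j = 0 then X else 0)" for j
    using deg by (intro badic_digit_degree_less) simp
  have close_X: "\<bar>poly_radical_inverse X X - poly_radical_inverse X (X - h)\<bar> \<le> 4 / 2 ^ m"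
  proof -
    have "\<bar>poly_radical_inverse X X - poly_radical_inverse X (X - h)\<bar>
        \<le> 2 / (real CARD('p) ^ degree X) ^ (m - 1)"
      using deg by (intro poly_radical_inverse_close_agree) (simp_all add: badic_digit_diff digit_X)
    then show ?thesis
      using m divide_power_pred[of m 2 2] by (simp add: deg card)
  qed
  have close_Z: "\<bar>poly_radical_inverse Z X - poly_radical_inverse Z (X - h)\<bar> \<le> 4 / 2 ^ m"
  proof -
    have "\<bar>poly_radical_inverse Z X - poly_radical_inverse Z (X - h)\<bar>
        \<le> 2 / (real CARD('p) ^ degree Z) ^ m"
      using deg by (intro poly_radical_inverse_close_agree) (simp_all add: badic_digit_diff digit_Z)
    also have "\<dots> \<le> 4 / 2 ^ m"
      by (simp add: deg card divide_right_mono)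
    finally show ?thesis .
  qed
  have close_B: "\<bar>poly_radical_inverse B X - poly_radical_inverse B (X - h)\<bar> \<le> 4 / 2 ^ m"
  proof -
    have "\<bar>poly_radical_inverse B X - poly_radical_inverse B (X - h)\<bar>
        \<le> 2 / (real CARD('p) ^ degree B) ^ m"
    \<comment> \<open>The choice f = X makes the leading digits X and X - (X + 1) = -1, of values 2
      and 1; the later digits of X - h are - (X + 1), of value 3 = 2 ^ 2 - 1.\<close>
    proof (intro poly_radical_inverse_close_carry[where J = 0])
      show "eval_at_p (badic_digit B X 0) = eval_at_p (badic_digit B (X - h) 0) + 1"
        using m by (simp add: badic_digit_diff digit_f digit_B) (simp add: X_def Z_def card minus1)
      show "eval_at_p (badic_digit B (X - h) j) = int CARD('p) ^ degree B - 1" if "0 < j" "j < m" for j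
        using that by (simp add: badic_digit_diff digit_f digit_B deg) (simp add: Z_def card minus1)
    qed (use m deg in \<open>simp_all add: badic_digit_diff digit_f\<close>)
    also have "\<dots> \<le> 4 / 2 ^ m"
    proof (intro frac_le)
      show "(2::real) ^ m \<le> (real CARD('p) ^ degree B) ^ m"
        by (intro power_mono) (simp_all add: deg card)
    qed simp_all
    finally show ?thesis .
  qed
  have "degree h \<le> (m - 1) + m"
    unfolding h_def
    using degree_mult_le[of "X ^ (m - 1)" "Z ^ m"] degree_power_le[of X "m - 1"]
      degree_power_le[of Z m] deg by simp
  \<comment> \<open>This gives N = 2 ^ (2 * m), for which 1 / 2 ^ m is N ^ (- 1 / 2), the rate for d
    = 3.\<close>
  then have deg_h: "degree h < 2 * m"
    using m by simp
  have "\<exists>i j. i < j \<and> j < CARD('p) ^ (2 * m) \<and>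
      edist 3 (halton b i) (halton b j) \<le> real 3 * (4 / 2 ^ m)"
  proof (rule halton_close_pair)
    have "h \<noteq> 0"
      using deg by (auto simp: h_def)
    then show "X \<noteq> X - h"
      by simp
    show "degree X < 2 * m"
      using deg m by simp
    then show "degree (X - h) < 2 * m"
      using deg_h by (rule degree_diff_less)
    fix i :: nat assume "i \<in> {1..3}"
    then have "i = 1 \<or> i = 2 \<or> i = 3"
      by auto
    then show "\<bar>poly_radical_inverse (b i) X - poly_radical_inverse (b i) (X - h)\<bar> \<le> 4 / 2 ^ m"
      using close_X close_Z close_B b by (auto simp: X_def Z_def B_def)
  qed
  then show ?thesis
    by (simp add: card)
qed

section \<open>All p linear bases simultaneously\<close>

definition borrow_cofactor :: "nat \<Rightarrow> 'p::prime_card mod_ring poly" where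
  "borrow_cofactor J = (\<Sum>i<CARD('p) - 1. ([:0, 1:] - [:0, 1:] ^ J) ^ i)"

text \<open>X ^ p - X is the product of X - s over all s in F_p, so the first factor makes the
  digits below position J - 1 vanish in each of these bases.\<close>

definition borrow_poly :: "nat \<Rightarrow> 'p::prime_card mod_ring poly" where
  "borrow_poly J = ([:0, 1:] ^ CARD('p) - [:0, 1:]) ^ (J - 1) * borrow_cofactor J"

text \<open>At \<open>Y = X - s\<close> we have \<open>X ^ p - X = Y ^ p - Y\<close> and \<open>X - X ^ J = Y - Y ^ J\<close> for a power \<open>J\<close>
  of \<open>p\<close>. Modulo \<open>Y ^ J\<close> the cofactor is thus \<open>(1 - Y ^ (p - 1)) / (1 - Y)\<close>, which turns
  \<open>(Y ^ (p - 1) - 1) ^ (J - 1)\<close> into \<open>1 / (1 - Y)\<close>, for all \<open>s\<close> simultaneously.\<close>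

lemma badic_digit_borrow_poly:
  fixes s :: "'p::prime_card mod_ring"
  assumes J: "J = CARD('p) ^ n" and j: "j < 2 * J - 1"
  shows "badic_digit [:- s, 1:] (borrow_poly J) j = (if j < J - 1 then 0 else 1)"
proof -
  define p where "p = CARD('p)"
  have p: "p \<ge> 2"
    using two_le_prime_card[where 'p='p] by (simp add: p_def)
  have J1: "J \<ge> 1"
    using two_le_prime_card[where 'p='p] by (simp add: J)
  define X :: "'p mod_ring poly" where "X = [:0, 1:]"
  define Y where "Y = [:- s, 1:]"
  have deg: "degree Y = 1"
    by (simp add: Y_def)
  have X: "X = Y + [:s:]"
    by (simp add: X_def Y_def)
  have frob: "X ^ CARD('p) ^ l - X = Y ^ CARD('p) ^ l - Y" for l
    unfolding X frobenius_poly_add frobenius_const by simp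
  define S where "S = (\<Sum>i<p - 1. Y ^ i)"
  define T where "T = (\<Sum>i<p - 1. (Y - Y ^ J) ^ i)"
  define G where "G = (\<Sum>t<J. Y ^ t)"
  define A where "A = (Y ^ (p - 1) - 1) ^ (J - 1)"
  have "X - X ^ J = Y - Y ^ J"
    using frob[of n] by (simp add: J algebra_simps)
  then have cof: "borrow_cofactor J = T"
    by (simp add: borrow_cofactor_def T_def X_def p_def)
  have "X ^ p - X = Y * (Y ^ (p - 1) - 1)"
    using frob[of 1] p power_pred_mult[of p Y] by (simp add: p_def right_diff_distrib)
  then have bp: "borrow_poly J = Y ^ (J - 1) * (A * T)"
    by (simp add: borrow_poly_def cof A_def X_def p_def power_mult_distrib mult.assoc)
  have "Y ^ J dvd T - S"
    unfolding T_def S_def sum_subtractf [symmetric]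
  proof (rule dvd_sum)
    fix i
    have "(Y - Y ^ J) - Y dvd (Y - Y ^ J) ^ i - Y ^ i"
      unfolding power_diff_sumr2 by (rule dvd_triv_left)
    then show "Y ^ J dvd (Y - Y ^ J) ^ i - Y ^ i"
      by simp
  qed
  moreover have "(1 - Y) * S = 1 - Y ^ (p - 1)"
    by (simp add: S_def one_diff_power_eq)
  moreover have "(1 - Y) * G = 1 - Y ^ J"
    by (simp add: G_def one_diff_power_eq)
  \<comment> \<open>One more factor completes the exponent J - 1 of \<open>A\<close> to the power
    \<open>J\<close> of p, where Frobenius expands it.\<close>
  moreover have "A * (1 - Y ^ (p - 1)) = 1 - Y ^ (J * (p - 1))"
  proof -
    have "A * (1 - Y ^ (p - 1)) = - ((Y ^ (p - 1) - 1) * A)"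
      by (simp add: algebra_simps)
    also have "(Y ^ (p - 1) - 1) * A = (Y ^ (p - 1) - 1) ^ J"
      unfolding A_def using J1 by (rule power_pred_mult)
    also have "(Y ^ (p - 1) - 1) ^ J = Y ^ (J * (p - 1)) - 1"
      using frobenius_poly_diff[of "Y ^ (p - 1)" 1 n] by (simp add: J mult.commute flip: power_mult)
    finally show ?thesis
      by simp
  qed
  moreover have "Y ^ J dvd Y ^ (J * (p - 1))"
    using p by (intro le_imp_power_dvd) auto
  \<comment> \<open>Modulo Y ^ J the first summand vanishes because of T - S, and the second equals
    Y ^ J - Y ^ (J * (p - 1)).\<close>
  moreover have "(1 - Y) * (A * T - G) =
      A * (1 - Y) * (T - S) + (A * ((1 - Y) * S) - (1 - Y) * G)"
    by (simp add: algebra_simps)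
  ultimately have "Y ^ J dvd (1 - Y) * (A * T - G)"
    by (simp add: dvd_add dvd_diff dvd_mult)
  moreover have "coprime Y (1 - Y)"
  proof (rule coprimeI)
    fix c assume "c dvd Y" "c dvd 1 - Y"
    then show "is_unit c"
      using dvd_add[of c Y "1 - Y"] by simp
  qed
  ultimately have "Y ^ J dvd A * T - G"
    by (simp add: coprime_dvd_mult_right_iff)
  then obtain r where "A * T - G = Y ^ J * r" ..
  then have "A * T = (\<Sum>t<J. 1 * Y ^ t) + r * Y ^ J"
    by (simp add: G_def algebra_simps)
  then have digit: "badic_digit Y (A * T) t = 1" if "t < J" for t
    using that deg by (intro badic_digit_eqI[where k = J]) auto
  \<comment> \<open>The factor Y ^ (J - 1) moves the J digits 1 of A * T to the positions J - 1,
    ..., 2 * J - 2.\<close>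
  show ?thesis
    unfolding bp Y_def [symmetric] using j deg by (simp add: badic_digit_power_mult digit)
qed

text \<open>The two factors give degree at most p * (J - 1) + J * (p - 2) = 2 * (p - 1) * J - p.
  Prescribing about 2 * J digits in p coprime linear bases would in general cost degree about 2 * p
  * J; saving the share of one base turns the exponent 1 / d into 1 / (d - 1).\<close>

lemma degree_borrow_poly:
  assumes "J \<ge> 1"
  shows "degree (borrow_poly J :: 'p::prime_card mod_ring poly) < 2 * (CARD('p) - 1) * J"
proof -
  define p where "p = CARD('p)"
  have p: "p \<ge> 2"
    using two_le_prime_card[where 'p='p] by (simp add: p_def)
  define X :: "'p mod_ring poly" where "X = [:0, 1:]"
  have X: "degree (X ^ i) \<le> i" for i
    using degree_power_le[of X i] by (simp add: X_def)
  have "degree (borrow_cofactor J :: 'p mod_ring poly) \<le> J * (p - 2)"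
    unfolding borrow_cofactor_def X_def [symmetric]
  proof (rule degree_sum_le)
    fix i assume "i \<in> {..<CARD('p) - 1}"
    then have i: "i \<le> p - 2"
      by (auto simp: p_def)
    have "degree (X - X ^ J) \<le> J"
      using assms X[of 1] X[of J] by (intro degree_diff_le) auto
    then have "degree ((X - X ^ J) ^ i) \<le> J * i"
      using degree_power_le order_trans mult_le_mono1 by metis
    also have "\<dots> \<le> J * (p - 2)"
      using i by simp
    finally show "degree ((X - X ^ J) ^ i) \<le> J * (p - 2)" .
  qed simp
  moreover have "degree ((X ^ p - X) ^ (J - 1)) \<le> p * (J - 1)"
  proof -
    have "degree (X ^ p - X) \<le> p"
      using p X[of 1] X[of p] by (intro degree_diff_le) auto
    then show ?thesis
      using degree_power_le order_trans mult_le_mono1 by metis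
  qed
  ultimately have "degree (borrow_poly J :: 'p mod_ring poly) \<le> p * (J - 1) + J * (p - 2)"
    unfolding borrow_poly_def X_def [symmetric] p_def [symmetric]
    using degree_mult_le add_mono order_trans by metis
  also have "\<dots> < 2 * (p - 1) * J"
  proof -
    obtain p' J' where "p = p' + 2" "J = J' + 1"
      using p assms by (metis le_add_diff_inverse2)
    then show ?thesis
      by (simp add: algebra_simps)
  qed
  finally show ?thesis
    by (simp add: p_def)
qed

text \<open>X ^ (J - 1) is monic of degree J - 1, so in every base X - s its digits from position J
  - 1 on are 1, 0, 0, ...; subtracting \<open>borrow_poly J\<close> keeps the lower digits and turns
  these into 0, -1, -1, ... up to position 2 * J - 2.\<close>

lemma halton_close_all_linear:
  fixes b :: "nat \<Rightarrow> 'p::prime_card mod_ring poly"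
  assumes b: "\<And>i. i \<in> {1..CARD('p)} \<Longrightarrow> \<exists>s. b i = [:- s, 1:]"
    and J_def: "J = CARD('p) ^ n"
  shows "\<exists>i j. i < j \<and> j < CARD('p) ^ (2 * (CARD('p) - 1) * J) \<and>
    edist CARD('p) (halton b i) (halton b j) \<le> 2 * real CARD('p) ^ 2 / real CARD('p) ^ (2 * J)"
proof -
  define p where "p = CARD('p)"
  have p: "p \<ge> 2"
    using two_le_prime_card[where 'p='p] by (simp add: p_def)
  have J: "J \<ge> 1"
    using two_le_prime_card[where 'p='p] by (simp add: J_def)
  define X :: "'p mod_ring poly" where "X = [:0, 1:]"
  define f where "f = X ^ (J - 1)"
  define h :: "'p mod_ring poly" where "h = borrow_poly J"
  have deg_f: "degree f = J - 1" "lead_coeff f = 1"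
    unfolding f_def lead_coeff_power by (simp_all add: X_def degree_linear_power)
  have close: "\<bar>poly_radical_inverse Y f - poly_radical_inverse Y (f - h)\<bar> \<le> 2 * p / p ^ (2 * J)"
    if "Y = [:- s, 1:]" for Y s
  proof -
    have deg: "degree Y = 1"
      by (simp add: that)
    have digit_h: "badic_digit Y h j = (if j < J - 1 then 0 else 1)" if "j < 2 * J - 1" for j
      using badic_digit_borrow_poly[of J n j s] that by (simp add: J_def h_def \<open>Y = _\<close>)
    have "lead_coeff (Y ^ (J - 1)) = 1"
      unfolding lead_coeff_power by (simp add: that)
    moreover have "degree (Y ^ (J - 1)) = J - 1"
      by (simp add: that degree_linear_power)
    ultimately have "f div Y ^ (J - 1) = 1"
      using deg_f by (metis monic_div_eq_1)
    then have lead: "badic_digit Y f (J - 1) = 1"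
      using deg by (simp add: badic_digit_def mod_poly_less)
    have tail: "badic_digit Y f j = 0" if "J - 1 < j" for j
      using badic_expansion(2)[of Y f j] that deg deg_f by simp
    have "\<bar>poly_radical_inverse Y f - poly_radical_inverse Y (f - h)\<bar>
        \<le> 2 / (real CARD('p) ^ degree Y) ^ (2 * J - 1)"
      using deg J
      by (intro poly_radical_inverse_close_carry[where J = "J - 1"])
        (simp_all add: badic_digit_diff digit_h lead [simplified] tail eval_at_p_minus_one)
    \<comment> \<open>With 2 * J - 1 controlled digits the bound is 2 * p / p ^ (2 * J); the p
      coordinates later make this 2 * p ^ 2.\<close>
    then show ?thesis
      using J p divide_power_pred[of "2 * J" "real p" 2] by (simp add: deg p_def)
  qed
  have deg_h: "degree h < 2 * (p - 1) * J"
    using degree_borrow_poly[OF J, where 'p='p] by (simp add: h_def p_def)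
  have "1 * J \<le> 2 * (p - 1) * J"
    using p by (intro mult_le_mono1) auto
  then have deg_f': "degree f < 2 * (p - 1) * J"
    using deg_f J by linarith
  have "\<exists>i j. i < j \<and> j < CARD('p) ^ (2 * (p - 1) * J) \<and>
      edist p (halton b i) (halton b j) \<le> real p * (2 * p / p ^ (2 * J))"
  proof (rule halton_close_pair)
    have "badic_digit [:0, 1:] h (J - 1) = 1"
      using badic_digit_borrow_poly[OF J_def, of "J - 1" 0] J by (simp add: h_def)
    then have "h \<noteq> 0"
      by (auto simp: badic_digit_def)
    then show "f \<noteq> f - h"
      by simp
    show "degree f < 2 * (p - 1) * J"
      by (rule deg_f')
    show "degree (f - h) < 2 * (p - 1) * J"
      using deg_f' deg_h by (rule degree_diff_less)
    show "\<bar>poly_radical_inverse (b i) f - poly_radical_inverse (b i) (f - h)\<bar> \<le> 2 * p / p ^ (2 * J)"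
      if "i \<in> {1..p}" for i
      using b[of i] close that by (auto simp: p_def)
  qed
  then show ?thesis
    by (simp add: p_def power2_eq_square mult.assoc mult.left_commute)
qed

section \<open>The three cases combined\<close>

theorem theorem3p6:
  fixes b :: "nat \<Rightarrow> 'p::prime_card mod_ring poly" and d :: nat
  assumes "d \<ge> 1"
    and "\<forall>i\<in>{1..d}. degree (b i) \<ge> 1"
    and "\<forall>i\<in>{1..d}. \<forall>j\<in>{1..d}. i \<noteq> j \<longrightarrow> coprime (b i) (b j)"
    and "(d = 2 \<and> (\<exists>a. b 1 = [:a, 1:] \<and> b 2 = [:a + 1, 1:]))
       \<or> (d = 3 \<and> CARD('p) = 2 \<and> b 1 = [:0, 1:] \<and> b 2 = [:1, 1:] \<and> b 3 = [:1, 1, 1:])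
       \<or> (d = CARD('p) \<and> (\<forall>i\<in>{1..d}. b i = [:- of_nat (i - 1), 1:]))"
  shows "(\<exists>c>0. infinite {N. separation_radius d (halton b) N
                               \<le> c / real N powr (1 / (real d - 1))})
       \<and> \<not> quasi_uniform d (halton b)"
proof -
  define p where "p = CARD('p)"
  have p: "p \<ge> 2"
    using two_le_prime_card[where 'p='p] by (simp add: p_def)
  have less_power: "m < p ^ m" for m
    using p by (metis less_exp order_less_le_trans power_mono zero_le)
  have "d \<ge> 2"
    using assms(4) p by (auto simp: p_def)
  moreover have "\<exists>c>0. \<forall>m. \<exists>N>m. \<exists>i j. i < j \<and> j < N \<and>
      edist d (halton b i) (halton b j) \<le> c / real N powr (1 / (real d - 1))"
    using assms(4)
  proof (elim disjE conjE exE)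
    fix a
    assume d: "d = 2" and b: "b 1 = [:a, 1:]" "b 2 = [:a + 1, 1:]"
    show ?thesis
    proof (intro exI[of _ "4 * real p"] conjI allI)
      fix m
      have "m < p ^ (p ^ m)"
        using less_power order_less_trans by blast
      moreover have "real (p ^ (p ^ m)) powr (1 / (real d - 1)) = real p ^ (p ^ m)"
        by (simp add: d)
      ultimately show "\<exists>N>m. \<exists>i j. i < j \<and> j < N \<and>
          edist d (halton b i) (halton b j) \<le> 4 * real p / real N powr (1 / (real d - 1))"
        using halton_close_two_linear[OF b refl, of m]
        by (intro exI[of _ "p ^ (p ^ m)"]) (simp add: d p_def)
    qed (use p in simp)
  next
    assume d: "d = 3" and card: "CARD('p) = 2"
      and b: "b 1 = [:0, 1:]" "b 2 = [:1, 1:]" "b 3 = [:1, 1, 1:]"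
    show ?thesis
    proof (intro exI[of _ "12 :: real"] conjI allI)
      fix m
      have "m < 2 ^ m" "2 ^ m < (2::nat) ^ (2 ^ m)" "(2::nat) ^ (2 ^ m) \<le> 2 ^ (2 * 2 ^ m)"
        by (simp_all add: power_increasing)
      then have "m < 2 ^ (2 * 2 ^ m)"
        by linarith
      moreover have "real (2 ^ (2 * 2 ^ m)) powr (1 / (real d - 1)) = 2 ^ (2 ^ m)"
        using power_powr_inverse[of 2 2 "2 ^ m"] by (simp add: d)
      ultimately show "\<exists>N>m. \<exists>i j. i < j \<and> j < N \<and>
          edist d (halton b i) (halton b j) \<le> 12 / real N powr (1 / (real d - 1))"
        using halton_close_quadratic[OF card b refl, of m]
        by (intro exI[of _ "2 ^ (2 * 2 ^ m)"]) (simp add: d)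
    qed simp
  next
    assume d: "d = CARD('p)" and b: "\<forall>i\<in>{1..d}. b i = [:- of_nat (i - 1), 1:]"
    show ?thesis
    proof (intro exI[of _ "2 * real p ^ 2"] conjI allI)
      fix m
      \<comment> \<open>With J = p ^ m the exponent is the degree bound for
        \<open>borrow_poly J\<close>; the root of order d - 1 = p - 1 is p ^ (2 * J), the
        denominator in the bound for the close pair.\<close>
      define N where "N = p ^ (2 * (p - 1) * p ^ m)"
      have "1 * p ^ m \<le> 2 * (p - 1) * p ^ m"
        using p by (intro mult_le_mono1) auto
      then have "p ^ p ^ m \<le> N"
        using p unfolding N_def by (intro power_increasing) auto
      then have "m < N"
        using less_power[of m] less_power[of "p ^ m"] by linarith
      moreover have "real N powr (1 / (real d - 1)) = real p ^ (2 * p ^ m)"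
        using power_powr_inverse[of "p - 1" p "2 * p ^ m"] p
        by (simp add: d N_def p_def of_nat_diff mult_ac)
      moreover have "\<exists>i j. i < j \<and> j < N \<and>
          edist d (halton b i) (halton b j) \<le> 2 * real p ^ 2 / real p ^ (2 * p ^ m)"
      proof -
        have "\<exists>s. b i = [:- s, 1:]" if "i \<in> {1..CARD('p)}" for i
          using b that d by blast
        then show ?thesis
          using halton_close_all_linear[of b "p ^ m" m] by (simp add: d p_def N_def)
      qed
      ultimately show "\<exists>N>m. \<exists>i j. i < j \<and> j < N \<and>
          edist d (halton b i) (halton b j) \<le> 2 * real p ^ 2 / real N powr (1 / (real d - 1))"
        by (intro exI[of _ N]) simp
    qed (use p in simp)
  qed
  ultimately show ?thesis
    using small_separation[of d _ "halton b"] by blast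
qed

end
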